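(* Let $t$ be an indeterminate. For every integer $n\ge 0$, $$\sum_{k=0}^n t^k \left(L_k +(t-2)F_{k+1}\right) = t^{n+1}F_{n+1},$$ where $F_k$ and $L_k$ are the $k$th Fibonacci and Lucas numbers.
   Context: The Fibonacci numbers $F_k$ and Lucas numbers $L_k$ ($k\ge 0$) both satisfy $x_{n+2}=x_{n+1}+x_n$ for $n\ge 0$, with initial values $F_0=0$, $F_1=1$ and $L_0=2$, $L_1=1$. *)

theory Defs
  imports "HOL-Number_Theory.Fib" "HOL-Computational_Algebra.Polynomial"
begin

fun lucas :: "nat \<Rightarrow> nat" where
  "lucas 0 = 2"
| "lucas (Suc 0) = 1"
| "lucas (Suc (Suc n)) = lucas (Suc n) + lucas n"

(* The indeterminate of the polynomial ring Z[t]. *)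
abbreviation indet :: "int poly" where
  "indet \<equiv> [:0, 1:]"

end

(* Since L_k = 2 F_(k+1) - F_k, the k-th summand equals t^(k+1) F_(k+1) - t^k F_k,
   so the sum telescopes. *)
theory Submission
  imports Defs
begin

text \<open>The telescoping rests on \<open>lucas_add_fib\<close>: it makes the terms 2 F_(k+1) in
  each summand cancel. Only ring arithmetic in t is involved, so t may be any element of a
  commutative ring.\<close>

text \<open>Both sides satisfy the Fibonacci recurrence and agree at k = 0 and k = 1. The additive
  form avoids truncated subtraction on \<open>nat\<close>.\<close>

lemma lucas_add_fib: "lucas k + fib k = 2 * fib (Suc k)"
  by (induction k rule: lucas.induct) simp_all

lemma sum_power_lucas_fib:
  fixes t :: "'a::comm_ring_1"
  shows "(\<Sum>k=0..n. t ^ k * (of_nat (lucas k) + (t - 2) * of_nat (fib (k + 1))))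
           = t ^ (n + 1) * of_nat (fib (n + 1))"
proof -
  have lucas: "of_nat (lucas k) = 2 * of_nat (fib (Suc k)) - (of_nat (fib k) :: 'a)" for k
    using arg_cong[OF lucas_add_fib[of k], of "of_nat :: nat \<Rightarrow> 'a"]
    by (simp add: eq_diff_eq)
  have "(\<Sum>k=0..n. t ^ k * (of_nat (lucas k) + (t - 2) * of_nat (fib (k + 1))))
          = (\<Sum>k=0..n. t ^ Suc k * of_nat (fib (Suc k)) - t ^ k * of_nat (fib k))"
    by (rule sum.cong) (simp_all only: lucas Suc_eq_plus1[symmetric], simp add: algebra_simps)
  also have "\<dots> = t ^ (n + 1) * of_nat (fib (n + 1))"
    \<comment> \<open>The lower boundary term \<open>t ^ 0 * of_nat (fib 0)\<close> vanishes since
      F_0 = 0.\<close>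
    by (subst sum_Suc_diff) simp_all
  finally show ?thesis .
qed

theorem mainTheorem2:
  fixes n :: nat
  shows "(\<Sum>k=0..n. indet ^ k * (of_nat (lucas k) + (indet - 2) * of_nat (fib (k + 1))))
           = indet ^ (n + 1) * of_nat (fib (n + 1))"
  by (rule sum_power_lucas_fib)

end
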